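(* Let $Q=(Q,\cdot)$ be a quasigroup with parastrophes $Q_1,\dots,Q_5$. Then all parastrophes of $Q$ are isotopic to $Q$ (i.e. $Q\approx Q_j$ for all $j=1,\dots,5$) if and only if $Q\sim Q$ and $Q\sim Q_i$ for some $i\in\{1,2,3,4\}$.
   Context: $S_Q$ is the set of all permutations of the set $Q$. Quasigroups $(Q,\cdot)$ and $(Q,\circ)$ on the same set are isotopic, written $(Q,\cdot)\approx(Q,\circ)$, if there are $\alpha,\beta,\gamma\in S_Q$ with $\alpha(x)\circ\beta(y)=\gamma(x\cdot y)$ for all $x,y\in Q$. They are anti-isotopic, written $(Q,\cdot)\sim(Q,\circ)$, if there are $\alpha,\beta,\gamma\in S_Q$ with $\alpha(x)\circ\beta(y)=\gamma(y\cdot x)$ for all $x,y\in Q$. The parastrophes $Q_i=(Q,\circ_i)$, $i=1,\dots,5$, of a quasigroup $(Q,\cdot)$ are defined by: $x\circ_1 y=z\iff x\cdot z=y$; $x\circ_2 y=z\iff z\cdot y=x$; $x\circ_3 y=z\iff z\cdot x=y$; $x\circ_4 y=z\iff y\cdot z=x$; $x\circ_5 y=z\iff y\cdot x=z$. *)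

theory Defs
  imports "HOL-Combinatorics.Permutations"
begin

definition quasigroup :: "'a set \<Rightarrow> ('a \<Rightarrow> 'a \<Rightarrow> 'a) \<Rightarrow> bool" where
  "quasigroup Q f \<longleftrightarrow>
     (\<forall>x\<in>Q. \<forall>y\<in>Q. f x y \<in> Q) \<and>
     (\<forall>a\<in>Q. \<forall>b\<in>Q. \<exists>!x. x \<in> Q \<and> f a x = b) \<and>
     (\<forall>a\<in>Q. \<forall>b\<in>Q. \<exists>!y. y \<in> Q \<and> f y a = b)"

definition isotopic :: "'a set \<Rightarrow> ('a \<Rightarrow> 'a \<Rightarrow> 'a) \<Rightarrow> ('a \<Rightarrow> 'a \<Rightarrow> 'a) \<Rightarrow> bool" where
  "isotopic Q f g \<longleftrightarrow>
     (\<exists>\<alpha> \<beta> \<gamma>. \<alpha> permutes Q \<and> \<beta> permutes Q \<and> \<gamma> permutes Q \<and>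
        (\<forall>x\<in>Q. \<forall>y\<in>Q. g (\<alpha> x) (\<beta> y) = \<gamma> (f x y)))"

definition anti_isotopic :: "'a set \<Rightarrow> ('a \<Rightarrow> 'a \<Rightarrow> 'a) \<Rightarrow> ('a \<Rightarrow> 'a \<Rightarrow> 'a) \<Rightarrow> bool" where
  "anti_isotopic Q f g \<longleftrightarrow>
     (\<exists>\<alpha> \<beta> \<gamma>. \<alpha> permutes Q \<and> \<beta> permutes Q \<and> \<gamma> permutes Q \<and>
        (\<forall>x\<in>Q. \<forall>y\<in>Q. g (\<alpha> x) (\<beta> y) = \<gamma> (f y x)))"

text \<open>The index \<open>i\<close> is meant to range over \<open>{1..5}\<close>. The description is well defined on
  \<open>Q\<close> for a quasigroup, as the lemma \<open>parastrophe_iff\<close> below shows; for other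
  indices, or arguments outside \<open>Q\<close>, the value is irrelevant.\<close>

definition parastrophe ::
  "'a set \<Rightarrow> ('a \<Rightarrow> 'a \<Rightarrow> 'a) \<Rightarrow> nat \<Rightarrow> 'a \<Rightarrow> 'a \<Rightarrow> 'a" where
  "parastrophe Q f i x y = (THE z. z \<in> Q \<and>
     (i = 1 \<and> f x z = y \<or>
      i = 2 \<and> f z y = x \<or>
      i = 3 \<and> f z x = y \<or>
      i = 4 \<and> f y z = x \<or>
      i = 5 \<and> f y x = z))"

lemma parastrophe_iff:
  assumes "quasigroup Q f" "x \<in> Q" "y \<in> Q" "z \<in> Q"
  shows "parastrophe Q f 1 x y = z \<longleftrightarrow> f x z = y"
    and "parastrophe Q f 2 x y = z \<longleftrightarrow> f z y = x"
    and "parastrophe Q f 3 x y = z \<longleftrightarrow> f z x = y"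
    and "parastrophe Q f 4 x y = z \<longleftrightarrow> f y z = x"
    and "parastrophe Q f 5 x y = z \<longleftrightarrow> f y x = z"
proof -
  have the: "(THE w. w \<in> Q \<and> P w) = z \<longleftrightarrow> P z" if "\<exists>!w. w \<in> Q \<and> P w" for P
  proof
    show "P z" if "(THE w. w \<in> Q \<and> P w) = z"
      using theI'[OF \<open>\<exists>!w. w \<in> Q \<and> P w\<close>] that by blast
    show "(THE w. w \<in> Q \<and> P w) = z" if "P z"
      using the1_equality[OF \<open>\<exists>!w. w \<in> Q \<and> P w\<close>] that \<open>z \<in> Q\<close> by blast
  qed
  have left: "\<exists>!w. w \<in> Q \<and> f a w = b" and right: "\<exists>!w. w \<in> Q \<and> f w a = b"
    if "a \<in> Q" "b \<in> Q" for a b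
    using assms(1) that unfolding quasigroup_def by simp_all
  have op: "\<exists>!w. w \<in> Q \<and> f y x = w"
    using assms unfolding quasigroup_def by auto
  show "parastrophe Q f 1 x y = z \<longleftrightarrow> f x z = y"
    using the[OF left[OF assms(2,3)]] by (simp add: parastrophe_def)
  show "parastrophe Q f 2 x y = z \<longleftrightarrow> f z y = x"
    using the[OF right[OF assms(3,2)]] by (simp add: parastrophe_def)
  show "parastrophe Q f 3 x y = z \<longleftrightarrow> f z x = y"
    using the[OF right[OF assms(2,3)]] by (simp add: parastrophe_def)
  show "parastrophe Q f 4 x y = z \<longleftrightarrow> f y z = x"
    using the[OF left[OF assms(3,2)]] by (simp add: parastrophe_def)
  show "parastrophe Q f 5 x y = z \<longleftrightarrow> f y x = z"
    using the[OF op] by (simp add: parastrophe_def)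
qed

end

theory Submission
  imports Defs
begin

text \<open>A quasigroup is determined by the ternary relation \<open>f x y = z\<close>, and passing to a
  parastrophe permutes the three places of that relation. The place permutations that
  yield an isotopic relation form a subgroup of the symmetric group \<open>S\<^sub>3\<close>. The condition
  \<open>Q \<sim> Q\<close> puts the transposition of the first two places into this subgroup, and
  \<open>Q \<sim> Q\<^sub>i\<close> with \<open>i \<le> 4\<close> adds a place permutation moving the third place; together
  they generate \<open>S\<^sub>3\<close>.\<close>

text \<open>Here all three places are treated alike, whereas in \<open>isotopic\<close> the third
  one is the value of an operation. This lets a permutation of the places act on both relations at
  once.\<close>

definition rel_isotopic ::
  "'a set \<Rightarrow> ('a \<Rightarrow> 'a \<Rightarrow> 'a \<Rightarrow> bool) \<Rightarrow> ('a \<Rightarrow> 'a \<Rightarrow> 'a \<Rightarrow> bool) \<Rightarrow> bool" where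
  "rel_isotopic Q R S \<longleftrightarrow>
     (\<exists>\<alpha> \<beta> \<gamma>. \<alpha> permutes Q \<and> \<beta> permutes Q \<and> \<gamma> permutes Q \<and>
        (\<forall>x\<in>Q. \<forall>y\<in>Q. \<forall>z\<in>Q. R x y z \<longleftrightarrow> S (\<alpha> x) (\<beta> y) (\<gamma> z)))"

lemma rel_isotopic_sym:
  assumes "rel_isotopic Q R S"
  shows "rel_isotopic Q S R"
proof -
  obtain \<alpha> \<beta> \<gamma> where p: "\<alpha> permutes Q" "\<beta> permutes Q" "\<gamma> permutes Q"
    and eq: "\<And>x y z. x \<in> Q \<Longrightarrow> y \<in> Q \<Longrightarrow> z \<in> Q \<Longrightarrow> R x y z \<longleftrightarrow> S (\<alpha> x) (\<beta> y) (\<gamma> z)"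
    using assms unfolding rel_isotopic_def by blast
  have "S x y z \<longleftrightarrow> R (inv \<alpha> x) (inv \<beta> y) (inv \<gamma> z)" if "x \<in> Q" "y \<in> Q" "z \<in> Q" for x y z
    using eq[of "inv \<alpha> x" "inv \<beta> y" "inv \<gamma> z"] that p
    by (simp add: permutes_inverses permutes_in_image[OF permutes_inv])
  moreover have "inv \<alpha> permutes Q" "inv \<beta> permutes Q" "inv \<gamma> permutes Q"
    using p by (simp_all add: permutes_inv)
  ultimately show ?thesis
    unfolding rel_isotopic_def by blast
qed

lemma rel_isotopic_trans:
  assumes "rel_isotopic Q R S" "rel_isotopic Q S T"
  shows "rel_isotopic Q R T"
proof -
  obtain \<alpha> \<beta> \<gamma> where p: "\<alpha> permutes Q" "\<beta> permutes Q" "\<gamma> permutes Q"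
    and eq: "\<And>x y z. x \<in> Q \<Longrightarrow> y \<in> Q \<Longrightarrow> z \<in> Q \<Longrightarrow> R x y z \<longleftrightarrow> S (\<alpha> x) (\<beta> y) (\<gamma> z)"
    using assms(1) unfolding rel_isotopic_def by blast
  obtain \<alpha>' \<beta>' \<gamma>' where p': "\<alpha>' permutes Q" "\<beta>' permutes Q" "\<gamma>' permutes Q"
    and eq': "\<And>x y z. x \<in> Q \<Longrightarrow> y \<in> Q \<Longrightarrow> z \<in> Q \<Longrightarrow> S x y z \<longleftrightarrow> T (\<alpha>' x) (\<beta>' y) (\<gamma>' z)"
    using assms(2) unfolding rel_isotopic_def by blast
  have "R x y z \<longleftrightarrow> T ((\<alpha>' \<circ> \<alpha>) x) ((\<beta>' \<circ> \<beta>) y) ((\<gamma>' \<circ> \<gamma>) z)"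
    if "x \<in> Q" "y \<in> Q" "z \<in> Q" for x y z
    using that eq eq' p by (simp add: permutes_in_image)
  moreover have "(\<alpha>' \<circ> \<alpha>) permutes Q" "(\<beta>' \<circ> \<beta>) permutes Q" "(\<gamma>' \<circ> \<gamma>) permutes Q"
    using p p' by (simp_all add: permutes_compose)
  ultimately show ?thesis
    unfolding rel_isotopic_def by blast
qed

text \<open>The witnesses trade roles together with the places they act on.\<close>

lemma rel_isotopic_swap12:
  "rel_isotopic Q R S \<Longrightarrow> rel_isotopic Q (\<lambda>x y z. R y x z) (\<lambda>x y z. S y x z)"
  unfolding rel_isotopic_def by blast

lemma rel_isotopic_swap23:
  "rel_isotopic Q R S \<Longrightarrow> rel_isotopic Q (\<lambda>x y z. R x z y) (\<lambda>x y z. S x z y)"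
  unfolding rel_isotopic_def by blast

text \<open>Permutations of \<open>Q\<close> map \<open>Q\<close> into itself, so only the values of
  \<open>S\<close> on \<open>Q\<close> matter. This makes room for parastrophes, which are
  controlled only on \<open>Q\<close>.\<close>

lemma rel_isotopic_cong:
  assumes "\<And>x y z. x \<in> Q \<Longrightarrow> y \<in> Q \<Longrightarrow> z \<in> Q \<Longrightarrow> S x y z \<longleftrightarrow> S' x y z"
  shows "rel_isotopic Q R S \<longleftrightarrow> rel_isotopic Q R S'"
proof -
  have "(\<forall>x\<in>Q. \<forall>y\<in>Q. \<forall>z\<in>Q. R x y z \<longleftrightarrow> S (\<alpha> x) (\<beta> y) (\<gamma> z)) \<longleftrightarrow>
      (\<forall>x\<in>Q. \<forall>y\<in>Q. \<forall>z\<in>Q. R x y z \<longleftrightarrow> S' (\<alpha> x) (\<beta> y) (\<gamma> z))"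
    if "\<alpha> permutes Q" "\<beta> permutes Q" "\<gamma> permutes Q" for \<alpha> \<beta> \<gamma>
    using assms that by (simp add: permutes_in_image)
  then show ?thesis
    unfolding rel_isotopic_def by (simp cong: conj_cong)
qed

text \<open>One direction rests on the injectivity of \<open>\<gamma>\<close>; for the other,
  closure of \<open>f\<close> permits the choice \<open>z = f x y\<close>.\<close>

lemma isotopic_iff_rel_isotopic:
  assumes "\<And>x y. x \<in> Q \<Longrightarrow> y \<in> Q \<Longrightarrow> f x y \<in> Q"
  shows "isotopic Q f g \<longleftrightarrow> rel_isotopic Q (\<lambda>x y z. f x y = z) (\<lambda>x y z. g x y = z)"
proof -
  have "(\<forall>x\<in>Q. \<forall>y\<in>Q. g (\<alpha> x) (\<beta> y) = \<gamma> (f x y)) \<longleftrightarrow>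
      (\<forall>x\<in>Q. \<forall>y\<in>Q. \<forall>z\<in>Q. f x y = z \<longleftrightarrow> g (\<alpha> x) (\<beta> y) = \<gamma> z)"
    if "\<gamma> permutes Q" for \<alpha> \<beta> \<gamma>
    using assms by (fastforce simp: inj_eq[OF permutes_inj[OF that]])
  then show ?thesis
    unfolding isotopic_def rel_isotopic_def by (simp cong: conj_cong)
qed

lemma anti_isotopic_iff_isotopic:
  "anti_isotopic Q f g \<longleftrightarrow> isotopic Q (\<lambda>x y. f y x) g"
  unfolding anti_isotopic_def isotopic_def ..

text \<open>Each alternative yields the exchange of the last two places; composing it with the
  exchange of the first two gives the remaining rearrangements.\<close>

lemma rel_isotopic_all_places:
  assumes 12: "rel_isotopic Q R (\<lambda>x y z. R y x z)"
    and "rel_isotopic Q R (\<lambda>x y z. R x z y) \<or> rel_isotopic Q R (\<lambda>x y z. R z y x) \<or>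
      rel_isotopic Q R (\<lambda>x y z. R z x y) \<or> rel_isotopic Q R (\<lambda>x y z. R y z x)"
  shows "rel_isotopic Q R (\<lambda>x y z. R x z y)" "rel_isotopic Q R (\<lambda>x y z. R z y x)"
    "rel_isotopic Q R (\<lambda>x y z. R z x y)" "rel_isotopic Q R (\<lambda>x y z. R y z x)"
proof -
  \<comment> \<open>Exchange the first two places on both sides, then absorb the exchange on the
    left by \<open>12\<close>.\<close>
  have swap: "rel_isotopic Q R (\<lambda>x y z. S y x z)" if "rel_isotopic Q R S" for S
    by (rule rel_isotopic_trans[OF 12 rel_isotopic_swap12[OF that]])
  \<comment> \<open>Exchanging the last two places on both sides of \<open>12\<close> links a
    transposition with a 3-cycle.\<close>
  have 23: "rel_isotopic Q (\<lambda>x y z. R x z y) (\<lambda>x y z. R z x y)"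
    using rel_isotopic_swap23[OF 12] .
  show xzy: "rel_isotopic Q R (\<lambda>x y z. R x z y)"
    using assms(2)
  proof (elim disjE)
    show ?thesis if "rel_isotopic Q R (\<lambda>x y z. R z y x)"
      by (rule rel_isotopic_trans[OF swap[OF that] rel_isotopic_sym[OF 23]])
    show ?thesis if "rel_isotopic Q R (\<lambda>x y z. R z x y)"
      by (rule rel_isotopic_trans[OF that rel_isotopic_sym[OF 23]])
    show ?thesis if "rel_isotopic Q R (\<lambda>x y z. R y z x)"
      using swap[OF that] .
  qed
  show zxy: "rel_isotopic Q R (\<lambda>x y z. R z x y)"
    by (rule rel_isotopic_trans[OF xzy 23])
  show "rel_isotopic Q R (\<lambda>x y z. R z y x)" using swap[OF zxy] .
  show "rel_isotopic Q R (\<lambda>x y z. R y z x)" using swap[OF xzy] .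
qed

theorem theorem2p9:
  fixes Q :: "'a set" and f :: "'a \<Rightarrow> 'a \<Rightarrow> 'a"
  assumes "quasigroup Q f"
  shows "(\<forall>j\<in>{1..5}. isotopic Q f (parastrophe Q f j)) \<longleftrightarrow>
    anti_isotopic Q f f \<and> (\<exists>i\<in>{1..4}. anti_isotopic Q f (parastrophe Q f i))"
proof -
  let ?R = "\<lambda>x y z. f x y = z"
  let ?G = "\<lambda>i x y z. parastrophe Q f i x y = z"
  have closed: "f x y \<in> Q" if "x \<in> Q" "y \<in> Q" for x y
    using assms that unfolding quasigroup_def by blast
  have iso: "isotopic Q f g \<longleftrightarrow> rel_isotopic Q ?R (\<lambda>x y z. g x y = z)" for g
    by (rule isotopic_iff_rel_isotopic) (rule closed)
  \<comment> \<open>Anti-isotopy is isotopy from the opposite operation, whose graph is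
    \<open>?R\<close> with the first two places exchanged.\<close>
  have anti: "anti_isotopic Q f g \<longleftrightarrow>
      rel_isotopic Q (\<lambda>x y z. ?R y x z) (\<lambda>x y z. g x y = z)" for g
    unfolding anti_isotopic_iff_isotopic
    by (rule isotopic_iff_rel_isotopic) (rule closed)
  \<comment> \<open>On \<open>Q\<close> the graph of each parastrophe is the graph of
    \<open>f\<close> with its places rearranged.\<close>
  have G: "rel_isotopic Q R (?G 1) \<longleftrightarrow> rel_isotopic Q R (\<lambda>x y z. ?R x z y)"
    "rel_isotopic Q R (?G 2) \<longleftrightarrow> rel_isotopic Q R (\<lambda>x y z. ?R z y x)"
    "rel_isotopic Q R (?G 3) \<longleftrightarrow> rel_isotopic Q R (\<lambda>x y z. ?R z x y)"
    "rel_isotopic Q R (?G 4) \<longleftrightarrow> rel_isotopic Q R (\<lambda>x y z. ?R y z x)"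
    "rel_isotopic Q R (?G 5) \<longleftrightarrow> rel_isotopic Q R (\<lambda>x y z. ?R y x z)" for R
    by (rule rel_isotopic_cong, rule parastrophe_iff[OF assms]; assumption)+
  have range: "{1..5} = {1, 2, 3, 4, 5::nat}" "{1..4} = {1, 2, 3, 4::nat}"
    by auto
  have anti_self: "anti_isotopic Q f f \<longleftrightarrow> rel_isotopic Q ?R (\<lambda>x y z. ?R y x z)"
    unfolding anti using rel_isotopic_sym by blast
  \<comment> \<open>When \<open>f\<close> is isotopic to its opposite, both lie in the same isotopy
    class, so isotopy from either one means the same.\<close>
  have anti_eq: "anti_isotopic Q f g \<longleftrightarrow> isotopic Q f g" if "anti_isotopic Q f f" for g
    using that rel_isotopic_trans rel_isotopic_sym unfolding iso anti by blast
  show ?thesis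
  proof
    assume "\<forall>j\<in>{1..5}. isotopic Q f (parastrophe Q f j)"
    \<comment> \<open>The fifth parastrophe is the opposite operation, so isotopy to it gives
      \<open>anti_isotopic Q f f\<close>; through \<open>anti_eq\<close> the first one then provides
      the witness \<open>i = 1\<close>.\<close>
    then have "isotopic Q f (parastrophe Q f 1)" "isotopic Q f (parastrophe Q f 5)"
      by simp_all
    moreover from this(2) have "anti_isotopic Q f f"
      unfolding iso G anti_self .
    ultimately show "anti_isotopic Q f f \<and>
        (\<exists>i\<in>{1..4}. anti_isotopic Q f (parastrophe Q f i))"
      unfolding range using anti_eq by blast
  next
    assume R: "anti_isotopic Q f f \<and>
        (\<exists>i\<in>{1..4}. anti_isotopic Q f (parastrophe Q f i))"
    then have 12: "rel_isotopic Q ?R (\<lambda>x y z. ?R y x z)"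
      unfolding anti_self by blast
    have "\<exists>i\<in>{1..4}. isotopic Q f (parastrophe Q f i)"
      using R anti_eq by blast
    then have "rel_isotopic Q ?R (\<lambda>x y z. ?R x z y) \<or> rel_isotopic Q ?R (\<lambda>x y z. ?R z y x) \<or>
        rel_isotopic Q ?R (\<lambda>x y z. ?R z x y) \<or> rel_isotopic Q ?R (\<lambda>x y z. ?R y z x)"
      unfolding range iso bex_simps G by blast
    \<comment> \<open>The four conclusions of the lemma settle \<open>j = 1\<close> to
      \<open>j = 4\<close> in this order; \<open>j = 5\<close> is \<open>12\<close> itself.\<close>
    from rel_isotopic_all_places[OF 12 this] 12
    show "\<forall>j\<in>{1..5}. isotopic Q f (parastrophe Q f j)"
      unfolding range iso ball_simps G by blast
  qed
qed

end
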